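(* Let $G$ be a nontrivial finite group with inverse-closed generating set $C$ such that $\Gamma=\mathrm{Cay}(G;C)$ is normal edge-transitive, and let $\Phi:=\Phi(G;C)$. Then there exist $k\geq 1$ and $N_1,\dots,N_k\in\mathcal{A}_{\max}(G;C)$ for which the following conditions hold, where $\Gamma_i:=\mathrm{Cay}(G/N_i;CN_i/N_i)$. (i) $\Phi=\bigcap_{i=1}^k N_i$, and the map $\zeta: g\Phi\mapsto (gN_1,\dots,gN_k)$ is a group isomorphism $G/\Phi\to\prod_{i=1}^k G/N_i$. (ii) For each $i\leq k$, $\Gamma_i$ is a connected normal edge-transitive Cayley graph of the finite characteristically simple group $G/N_i$, $\mathcal{A}(G/N_i;CN_i/N_i)=\{1\}$ (that is, its only element is the trivial subgroup), and $\zeta$ induces a graph isomorphism from $\mathrm{Cay}(G/\Phi;C\Phi/\Phi)$ onto a full subdirect product of $\prod_{i=1}^k\Gamma_i$.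
   Context: An inverse-closed generating set $C$ for a finite group $G$ is a non-empty subset $C\subseteq G\setminus\{1\}$ with $\langle C\rangle=G$ and $c^{-1}\in C$ for each $c\in C$. $\mathrm{Aut}(G;C)=\{\sigma\in\mathrm{Aut}(G)\mid C^\sigma=C\}$. Define $\mathcal{A}(G;C)=\{N\mid N\unlhd G,\ N\neq G,\ N^\sigma=N \text{ for all }\sigma\in\mathrm{Aut}(G;C)\}$, let $\mathcal{A}_{\max}(G;C)$ be the set of elements of $\mathcal{A}(G;C)$ maximal under inclusion, and let $\Phi(G;C)=\bigcap\{N\mid N\in\mathcal{A}_{\max}(G;C)\}$. For $N\unlhd G$, $CN/N=\{cN\mid c\in C\}\subseteq G/N$. Cayley graphs: $\mathrm{Cay}(G;C)$ is the undirected graph with vertex set $G$ whose edges are all pairs $\{g,h\}$ with $gh^{-1}\in C$. For $g\in G$ let $\rho_g:h\mapsto hg$ and $G_R=\{\rho_g\mid g\in G\}$. The group $N(G;C)=G_R\rtimes\mathrm{Aut}(G;C)$ acts as automorphisms of $\mathrm{Cay}(G;C)$, and $\mathrm{Cay}(G;C)$ is called normal edge-transitive if $N(G;C)$ is transitive on its edge set. A group is characteristically simple if its only characteristic subgroups are itself and the trivial subgroup. Graphs are finite, simple and undirected. A subgraph of $(V,E)$ is a graph $(V',E')$ with $V'\subseteq V$ and $E'\subseteq E$. A graph homomorphism $(V_1,E_1)\to(V_2,E_2)$ is a map $f:V_1\to V_2$ sending each edge to an edge; it is an epimorphism if it is onto on vertices, and full if the induced map $E_1\to E_2$ is onto; a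 full epimorphism is one which is both; an isomorphism is a full homomorphism that is bijective on vertices. The direct product $\prod_{i=1}^k\Gamma_i$ of graphs $\Gamma_i=(V_i,E_i)$ has vertex set $V_1\times\dots\times V_k$, and $\{u,v\}$ is an edge if and only if $\{u_i,v_i\}\in E_i$ for every $i$. A full subdirect product of $\prod_{i=1}^k\Gamma_i$ is a subgraph $\Delta$ of this direct product such that, for each $i$, the projection $\pi_i:\Delta\to\Gamma_i$, $u\mapsto u_i$, is a full epimorphism. *)

theory Defs
  imports "HOL-Algebra.Algebra"
begin

record 'v sgraph =
  gverts :: "'v set"
  gedges :: "'v set set"

text \<open>
  Finite, simple and undirected: every edge is an unordered pair of two distinct vertices.
\<close>
definition simple_graph :: "'v sgraph \<Rightarrow> bool" where
  "simple_graph \<Gamma> \<longleftrightarrow> finite (gverts \<Gamma>) \<and> (\<forall>e\<in>gedges \<Gamma>. e \<subseteq> gverts \<Gamma> \<and> card e = 2)"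

definition connected_graph :: "'v sgraph \<Rightarrow> bool" where
  "connected_graph \<Gamma> \<longleftrightarrow>
     gverts \<Gamma> \<noteq> {} \<and>
     (\<forall>u\<in>gverts \<Gamma>. \<forall>v\<in>gverts \<Gamma>. (u, v) \<in> {(x, y). {x, y} \<in> gedges \<Gamma>}\<^sup>*)"

definition subgraph_of :: "'v sgraph \<Rightarrow> 'v sgraph \<Rightarrow> bool" where
  "subgraph_of \<Delta> \<Gamma> \<longleftrightarrow> simple_graph \<Delta> \<and> gverts \<Delta> \<subseteq> gverts \<Gamma> \<and> gedges \<Delta> \<subseteq> gedges \<Gamma>"

definition graph_hom :: "('v \<Rightarrow> 'w) \<Rightarrow> 'v sgraph \<Rightarrow> 'w sgraph \<Rightarrow> bool" where
  "graph_hom f \<Gamma> \<Delta> \<longleftrightarrow>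
     simple_graph \<Gamma> \<and> simple_graph \<Delta> \<and>
     f \<in> gverts \<Gamma> \<rightarrow> gverts \<Delta> \<and> (\<forall>e\<in>gedges \<Gamma>. f ` e \<in> gedges \<Delta>)"

definition full_graph_hom :: "('v \<Rightarrow> 'w) \<Rightarrow> 'v sgraph \<Rightarrow> 'w sgraph \<Rightarrow> bool" where
  "full_graph_hom f \<Gamma> \<Delta> \<longleftrightarrow> graph_hom f \<Gamma> \<Delta> \<and> (\<lambda>e. f ` e) ` gedges \<Gamma> = gedges \<Delta>"

definition full_graph_epi :: "('v \<Rightarrow> 'w) \<Rightarrow> 'v sgraph \<Rightarrow> 'w sgraph \<Rightarrow> bool" where
  "full_graph_epi f \<Gamma> \<Delta> \<longleftrightarrow> full_graph_hom f \<Gamma> \<Delta> \<and> f ` gverts \<Gamma> = gverts \<Delta>"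

definition graph_iso :: "('v \<Rightarrow> 'w) \<Rightarrow> 'v sgraph \<Rightarrow> 'w sgraph \<Rightarrow> bool" where
  "graph_iso f \<Gamma> \<Delta> \<longleftrightarrow> full_graph_hom f \<Gamma> \<Delta> \<and> bij_betw f (gverts \<Gamma>) (gverts \<Delta>)"

text \<open>
  Tuples are extensional functions on the index set, the same encoding as in
  \<^const>\<open>product_group\<close>.
\<close>
definition direct_product_graph :: "'i set \<Rightarrow> ('i \<Rightarrow> 'v sgraph) \<Rightarrow> ('i \<Rightarrow> 'v) sgraph" where
  "direct_product_graph I \<Gamma> =
     \<lparr> gverts = (\<Pi>\<^sub>E i\<in>I. gverts (\<Gamma> i)),
       gedges = {{u, v} | u v. u \<in> (\<Pi>\<^sub>E i\<in>I. gverts (\<Gamma> i)) \<and> v \<in> (\<Pi>\<^sub>E i\<in>I. gverts (\<Gamma> i)) \<and>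
                               (\<forall>i\<in>I. {u i, v i} \<in> gedges (\<Gamma> i))} \<rparr>"

definition full_subdirect_product :: "'i set \<Rightarrow> ('i \<Rightarrow> 'v sgraph) \<Rightarrow> ('i \<Rightarrow> 'v) sgraph \<Rightarrow> bool" where
  "full_subdirect_product I \<Gamma> \<Delta> \<longleftrightarrow>
     subgraph_of \<Delta> (direct_product_graph I \<Gamma>) \<and>
     (\<forall>i\<in>I. full_graph_epi (\<lambda>u. u i) \<Delta> (\<Gamma> i))"

definition inverse_closed_generating_set :: "('a, 'b) monoid_scheme \<Rightarrow> 'a set \<Rightarrow> bool" where
  "inverse_closed_generating_set G C \<longleftrightarrow>
     C \<noteq> {} \<and> C \<subseteq> carrier G - {\<one>\<^bsub>G\<^esub>} \<and> generate G C = carrier G \<and> (\<forall>c\<in>C. inv\<^bsub>G\<^esub> c \<in> C)"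

definition Aut_fixing :: "('a, 'b) monoid_scheme \<Rightarrow> 'a set \<Rightarrow> ('a \<Rightarrow> 'a) set" where
  "Aut_fixing G C = {\<sigma> \<in> auto G. \<sigma> ` C = C}"

definition inv_normals :: "('a, 'b) monoid_scheme \<Rightarrow> 'a set \<Rightarrow> 'a set set" where
  "inv_normals G C = {N. N \<lhd> G \<and> N \<noteq> carrier G \<and> (\<forall>\<sigma>\<in>Aut_fixing G C. \<sigma> ` N = N)}"

definition max_inv_normals :: "('a, 'b) monoid_scheme \<Rightarrow> 'a set \<Rightarrow> 'a set set" where
  "max_inv_normals G C = {N \<in> inv_normals G C. \<forall>M\<in>inv_normals G C. N \<subseteq> M \<longrightarrow> M = N}"

text \<open>
  For a nontrivial finite group the family being intersected is nonempty, as the trivial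
  subgroup lies in \<^const>\<open>inv_normals\<close>.
\<close>
definition Phi_rel :: "('a, 'b) monoid_scheme \<Rightarrow> 'a set \<Rightarrow> 'a set" where
  "Phi_rel G C = \<Inter> (max_inv_normals G C)"

text \<open>
  \<open>CN/N\<close>, a subset of the carrier of \<open>G Mod N\<close>.  The library's quotient consists of right
  cosets; for normal \<open>N\<close> these are the left cosets used here.
\<close>
definition quot_set :: "('a, 'b) monoid_scheme \<Rightarrow> 'a set \<Rightarrow> 'a set \<Rightarrow> 'a set set" where
  "quot_set G C N = (\<lambda>c. c <#\<^bsub>G\<^esub> N) ` C"

definition Cay :: "('a, 'b) monoid_scheme \<Rightarrow> 'a set \<Rightarrow> 'a sgraph" where
  "Cay G C =
     \<lparr> gverts = carrier G,
       gedges = {{g, h} | g h. g \<in> carrier G \<and> h \<in> carrier G \<and> g \<otimes>\<^bsub>G\<^esub> inv\<^bsub>G\<^esub> h \<in> C} \<rparr>"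

definition right_regular :: "('a, 'b) monoid_scheme \<Rightarrow> ('a \<Rightarrow> 'a) set" where
  "right_regular G = {\<lambda>h\<in>carrier G. h \<otimes>\<^bsub>G\<^esub> g | g. g \<in> carrier G}"

text \<open>
  The group \<open>N(G;C)\<close>, as the internal product of its two factors in the symmetric group
  on \<open>carrier G\<close>.
\<close>
definition normal_cay_aut :: "('a, 'b) monoid_scheme \<Rightarrow> 'a set \<Rightarrow> ('a \<Rightarrow> 'a) set" where
  "normal_cay_aut G C = right_regular G <#>\<^bsub>BijGroup (carrier G)\<^esub> Aut_fixing G C"

definition normal_edge_transitive :: "('a, 'b) monoid_scheme \<Rightarrow> 'a set \<Rightarrow> bool" where
  "normal_edge_transitive G C \<longleftrightarrow>
     (\<forall>e\<in>gedges (Cay G C). \<forall>e'\<in>gedges (Cay G C). \<exists>\<tau>\<in>normal_cay_aut G C. \<tau> ` e = e')"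

definition characteristic_subgroup :: "'a set \<Rightarrow> ('a, 'b) monoid_scheme \<Rightarrow> bool" where
  "characteristic_subgroup H G \<longleftrightarrow> subgroup H G \<and> (\<forall>\<sigma>\<in>auto G. \<sigma> ` H = H)"

definition characteristically_simple :: "('a, 'b) monoid_scheme \<Rightarrow> bool" where
  "characteristically_simple G \<longleftrightarrow>
     (\<forall>H. characteristic_subgroup H G \<longrightarrow> H = {\<one>\<^bsub>G\<^esub>} \<or> H = carrier G)"

end

theory Submission
  imports Defs
begin

text \<open>
  Edge-transitivity of \<open>N(G;C)\<close> says that \<open>Aut(G;C)\<close> is transitive on \<open>C\<close> up to inversion.
  Hence a proper invariant normal subgroup cannot meet \<open>C\<close>, and, since \<open>Aut(G;C)\<close> acts on
  every quotient by an invariant normal subgroup, such quotients are again normal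
  edge-transitive.  By correspondence, maximality of \<open>N\<close> leaves only the trivial invariant
  normal subgroup in \<open>G/N\<close>; characteristic subgroups are invariant, so \<open>G/N\<close> is
  characteristically simple.
  If \<open>M\<close> is the intersection of the maximal invariant subgroups chosen so far and some
  further one \<open>K\<close> does not contain \<open>M\<close>, then \<open>MK = G\<close> by maximality, so adjoining \<open>K\<close>
  keeps the map to the product of the quotients surjective while shrinking \<open>M\<close>; the process
  stops at \<open>\<Phi>\<close>.  The image of the Cayley graph of \<open>G/\<Phi>\<close> is the required full subdirect
  product.
\<close>

section \<open>Left coset calculus in quotient groups\<close>

context normal
begin

text \<open>\<open>G Mod H\<close> is built from right cosets while \<open>quot_set\<close> uses
  left cosets. Normality identifies the two, so later quotient computations can be done with left
  cosets throughout.\<close>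

lemma FactGroup_carrier_lcoset: "carrier (G Mod H) = (\<lambda>g. g <# H) ` carrier G"
  using coset_eq by (auto simp: carrier_FactGroup)

lemma lcoset_in_FactGroup: "g \<in> carrier G \<Longrightarrow> g <# H \<in> carrier (G Mod H)"
  by (simp add: FactGroup_carrier_lcoset)

lemma FactGroup_mult_lcoset:
  "g \<in> carrier G \<Longrightarrow> h \<in> carrier G \<Longrightarrow> (g <# H) \<otimes>\<^bsub>G Mod H\<^esub> (h <# H) = (g \<otimes> h) <# H"
  using coset_eq rcos_sum by (metis m_closed mult_FactGroup)

lemma lcoset_group_hom: "group_hom G (G Mod H) (\<lambda>g. g <# H)"
  by (auto simp: group_hom_def group_hom_axioms_def hom_def is_group factorgroup_is_group
      lcoset_in_FactGroup FactGroup_mult_lcoset simp del: mult_FactGroup)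

lemma FactGroup_inv_lcoset:
  "g \<in> carrier G \<Longrightarrow> inv\<^bsub>G Mod H\<^esub> (g <# H) = inv g <# H"
  using group_hom.hom_inv[OF lcoset_group_hom] by simp

lemma lcoset_eq_iff:
  assumes "g \<in> carrier G" "h \<in> carrier G"
  shows "g <# H = h <# H \<longleftrightarrow> inv h \<otimes> g \<in> H"
proof
  assume "g <# H = h <# H"
  then have "g \<in> h <# H" using lcos_self[OF assms(1) subgroup_axioms] by simp
  then show "inv h \<otimes> g \<in> H" by (rule lcos_module_imp[OF is_group assms(2)])
next
  assume "inv h \<otimes> g \<in> H"
  then have "g \<in> h <# H" by (rule lcos_module_rev[OF is_group assms(2,1)])
  then show "g <# H = h <# H"
    using l_repr_independence[OF _ assms(2) subgroup_axioms] by simp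
qed

lemma lcoset_eq_subgroup_iff: "g \<in> carrier G \<Longrightarrow> g <# H = H \<longleftrightarrow> g \<in> H"
  using lcoset_eq_iff[of g \<one>] lcos_mult_one[OF subset] by simp

end

section \<open>Automorphisms and characteristic subgroups\<close>

lemma (in group) autoD:
  assumes "\<sigma> \<in> auto G"
  shows "\<sigma> \<in> hom G G" "\<sigma> \<in> extensional (carrier G)" "bij_betw \<sigma> (carrier G) (carrier G)"
    "group_hom G G \<sigma>"
  using assms by (auto simp: auto_def Bij_def group_hom_def group_hom_axioms_def is_group)

text \<open>Conjugation is cut down to the carrier because \<open>auto\<close> contains extensional
  maps only; its inverse is conjugation by \<open>inv g\<close>.\<close>

lemma (in group) inner_automorphism:
  assumes g: "g \<in> carrier G"
  shows "(\<lambda>x\<in>carrier G. g \<otimes> x \<otimes> inv g) \<in> auto G"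
proof -
  have "bij_betw (\<lambda>x\<in>carrier G. g \<otimes> x \<otimes> inv g) (carrier G) (carrier G)"
    by (rule bij_betwI[where g = "\<lambda>x. inv g \<otimes> x \<otimes> g"])
       (use g in \<open>auto simp: m_assoc, auto simp: m_assoc[symmetric]\<close>)
  moreover have "g \<otimes> (x \<otimes> y) \<otimes> inv g = g \<otimes> x \<otimes> inv g \<otimes> (g \<otimes> y \<otimes> inv g)"
    if "x \<in> carrier G" "y \<in> carrier G" for x y
  proof -
    have "inv g \<otimes> (g \<otimes> (y \<otimes> inv g)) = y \<otimes> inv g"
      using g that by (simp add: m_assoc[symmetric])
    then show ?thesis using g that by (simp add: m_assoc)
  qed
  ultimately show ?thesis
    using g by (auto simp: auto_def Bij_def hom_def)
qed

text \<open>Conjugations are automorphisms, so invariance under \<open>auto G\<close> includes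
  closure under conjugation.\<close>

lemma (in group) characteristic_subgroup_normal:
  assumes "characteristic_subgroup H G"
  shows "H \<lhd> G"
proof (rule normal_invI)
  show "subgroup H G" using assms by (simp add: characteristic_subgroup_def)
  fix x h assume x: "x \<in> carrier G" and h: "h \<in> H"
  have "h \<in> carrier G" using assms h by (auto simp: characteristic_subgroup_def dest: subgroup.subset)
  moreover have "(\<lambda>y\<in>carrier G. x \<otimes> y \<otimes> inv x) ` H = H"
    using assms inner_automorphism[OF x] unfolding characteristic_subgroup_def by blast
  ultimately show "x \<otimes> h \<otimes> inv x \<in> H"
    using h by (metis (no_types, lifting) imageI restrict_apply)
qed

text \<open>\<open>Aut_fixing G C\<close> is contained in \<open>auto G\<close>, so a proper
  characteristic subgroup, being normal, is a member of \<open>inv_normals G C\<close>.\<close>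

lemma (in group) characteristically_simple_if_inv_normals_trivial:
  assumes "inv_normals G C = {{\<one>}}"
  shows "characteristically_simple G"
  unfolding characteristically_simple_def
proof (intro allI impI)
  fix H assume H: "characteristic_subgroup H G"
  then have "\<forall>\<sigma>\<in>Aut_fixing G C. \<sigma> ` H = H"
    by (auto simp: characteristic_subgroup_def Aut_fixing_def)
  then have "H \<in> inv_normals G C" if "H \<noteq> carrier G"
    using that characteristic_subgroup_normal[OF H] by (simp add: inv_normals_def)
  then show "H = {\<one>} \<or> H = carrier G" using assms by auto
qed

section \<open>Cayley graphs and normal edge-transitivity\<close>

lemma inverse_closed_generating_setD:
  assumes "inverse_closed_generating_set G C"
  shows "C \<noteq> {}" "C \<subseteq> carrier G" "\<one>\<^bsub>G\<^esub> \<notin> C" "generate G C = carrier G"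
    "\<And>c. c \<in> C \<Longrightarrow> inv\<^bsub>G\<^esub> c \<in> C"
  using assms by (auto simp: inverse_closed_generating_set_def)

context group
begin

text \<open>The pair is unordered, so its ends may be read in either order. The condition is
  symmetric because \<open>h \<otimes> inv g\<close> is the inverse of
  \<open>g \<otimes> inv h\<close> and \<open>C\<close> is inverse-closed.\<close>

lemma Cay_edge_iff:
  assumes C: "inverse_closed_generating_set G C"
  shows "{g, h} \<in> gedges (Cay G C) \<longleftrightarrow> g \<in> carrier G \<and> h \<in> carrier G \<and> g \<otimes> inv h \<in> C"
proof -
  have "h \<otimes> inv g \<in> C" if "g \<in> carrier G" "h \<in> carrier G" "g \<otimes> inv h \<in> C" for g h
    using inverse_closed_generating_setD(5)[OF C that(3)] that
    by (simp add: inv_mult_group)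
  then show ?thesis by (auto simp: Cay_def doubleton_eq_iff)
qed

lemma Cay_simple_graph:
  assumes C: "inverse_closed_generating_set G C" and "finite (carrier G)"
  shows "simple_graph (Cay G C)"
proof -
  have "g \<noteq> h" if "g \<in> carrier G" "g \<otimes> inv h \<in> C" for g h
    using that inverse_closed_generating_setD(3)[OF C] by auto
  then show ?thesis using assms(2) by (auto simp: simple_graph_def Cay_def)
qed

text \<open>Left multiplication by a generator moves along an edge, so a word in the generators for
  \<open>v \<otimes> inv u\<close> describes a walk from \<open>u\<close> to
  \<open>v\<close>.\<close>

lemma Cay_connected:
  assumes C: "inverse_closed_generating_set G C"
  shows "connected_graph (Cay G C)"
proof -
  let ?R = "{(x, y). {x, y} \<in> gedges (Cay G C)}"
  note CD = inverse_closed_generating_setD[OF C]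
  have step: "(x, c \<otimes> x) \<in> ?R" if "c \<in> C" "x \<in> carrier G" for c x
  proof -
    have "c \<in> carrier G" using that CD by auto
    then have "x \<otimes> inv (c \<otimes> x) = inv c"
      using that by (simp add: inv_mult_group m_assoc[symmetric])
    then show ?thesis using that CD(5) \<open>c \<in> carrier G\<close> by (simp add: Cay_edge_iff[OF C])
  qed
  \<comment> \<open>All starting vertices are treated at once: for a product
    \<open>h1 \<otimes> h2\<close> the walk for \<open>h1\<close> has to start at
    \<open>h2 \<otimes> x\<close>.\<close>
  have walk: "\<forall>x\<in>carrier G. (x, g \<otimes> x) \<in> ?R\<^sup>*" if "g \<in> generate G C" for g
    using that
  proof (induction rule: generate.induct)
    case (eng h1 h2)
    then have "h1 \<in> carrier G" "h2 \<in> carrier G" using CD by auto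
    then show ?case using eng.IH
      by (metis (no_types, lifting) m_assoc m_closed rtrancl_trans)
  qed (use step CD(5) in \<open>auto intro!: r_into_rtrancl\<close>)
  have "(u, v) \<in> ?R\<^sup>*" if "u \<in> carrier G" "v \<in> carrier G" for u v
    using walk[of "v \<otimes> inv u"] that CD(4) by (auto simp: m_assoc)
  then show ?thesis by (auto simp: connected_graph_def Cay_def)
qed

lemma right_translation_Bij:
  assumes g: "g \<in> carrier G"
  shows "(\<lambda>h\<in>carrier G. h \<otimes> g) \<in> Bij (carrier G)"
proof -
  have "bij_betw (\<lambda>h\<in>carrier G. h \<otimes> g) (carrier G) (carrier G)"
    by (rule bij_betwI[where g = "\<lambda>x. x \<otimes> inv g"]) (use g in \<open>auto simp: m_assoc\<close>)
  then show ?thesis by (auto simp: Bij_def)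
qed

text \<open>Multiplication in \<open>BijGroup\<close> is composition with the right factor applied
  first, hence the automorphism acts before the translation.\<close>

lemma normal_cay_aut_eq:
  "normal_cay_aut G C =
    {\<lambda>h\<in>carrier G. \<sigma> h \<otimes> g | \<sigma> g. \<sigma> \<in> Aut_fixing G C \<and> g \<in> carrier G}"
proof -
  have "(\<lambda>h\<in>carrier G. h \<otimes> g) \<otimes>\<^bsub>BijGroup (carrier G)\<^esub> \<sigma> = (\<lambda>h\<in>carrier G. \<sigma> h \<otimes> g)"
    if "\<sigma> \<in> Aut_fixing G C" "g \<in> carrier G" for \<sigma> g
  proof -
    have \<sigma>: "\<sigma> \<in> Bij (carrier G)" using that by (auto simp: Aut_fixing_def auto_def)
    then show ?thesis
      using right_translation_Bij[OF that(2)] Bij_imp_funcset[OF \<sigma>]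
      by (auto simp: BijGroup_def compose_def fun_eq_iff)
  qed
  then show ?thesis
    by (fastforce simp: normal_cay_aut_def set_mult_def right_regular_def)
qed

text \<open>Right translation by \<open>inv h\<close> carries an edge \<open>{g, h}\<close> to
  \<open>{g \<otimes> inv h, \<one>}\<close>, and automorphisms fix \<open>\<one>\<close>. So only
  the action on \<open>C\<close> matters; the inverse enters because the two ends of an edge may be
  swapped.\<close>

lemma normal_edge_transitive_iff:
  assumes C: "inverse_closed_generating_set G C"
  shows "normal_edge_transitive G C \<longleftrightarrow>
    (\<forall>c\<in>C. \<forall>d\<in>C. \<exists>\<sigma>\<in>Aut_fixing G C. \<sigma> c = d \<or> \<sigma> c = inv d)"
    (is "?L \<longleftrightarrow> ?R")
proof
  note CD = inverse_closed_generating_setD[OF C]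
  assume ?L
  show ?R
  proof (intro ballI)
    fix c d assume cd: "c \<in> C" "d \<in> C"
    then have cdG: "c \<in> carrier G" "d \<in> carrier G" using CD by auto
    \<comment> \<open>These edges are chosen because \<open>\<sigma>\<close> fixes
      \<open>\<one>\<close>. If the ends match in order, then \<open>g\<close> is
      \<open>\<one>\<close> and \<open>\<sigma> c\<close> is \<open>d\<close>; if they match
      crosswise, then \<open>g\<close> is \<open>d\<close> and \<open>\<sigma> c\<close> is
      \<open>inv d\<close>.\<close>
    have "{c, \<one>} \<in> gedges (Cay G C)" "{d, \<one>} \<in> gedges (Cay G C)"
      using cd cdG by (auto simp: Cay_edge_iff[OF C])
    then obtain \<tau> where "\<tau> \<in> normal_cay_aut G C" "\<tau> ` {c, \<one>} = {d, \<one>}"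
      using \<open>?L\<close> unfolding normal_edge_transitive_def by blast
    then obtain \<sigma> g where \<sigma>: "\<sigma> \<in> Aut_fixing G C" and g: "g \<in> carrier G"
      and eq: "{\<sigma> c \<otimes> g, \<sigma> \<one> \<otimes> g} = {d, \<one>}"
      using cdG by (auto simp: normal_cay_aut_eq)
    have a: "\<sigma> \<in> auto G" and "\<sigma> c \<in> carrier G"
      using \<sigma> cd CD(2) by (auto simp: Aut_fixing_def)
    moreover have "\<sigma> \<one> = \<one>" using group_hom.hom_one[OF autoD(4)[OF a]] .
    ultimately have "\<sigma> c = d \<or> \<sigma> c = inv d"
      using eq g cdG by (auto simp: doubleton_eq_iff inv_equality)
    then show "\<exists>\<sigma>\<in>Aut_fixing G C. \<sigma> c = d \<or> \<sigma> c = inv d" using \<sigma> by blast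
  qed
next
  note CD = inverse_closed_generating_setD[OF C]
  assume R: ?R
  show ?L
    unfolding normal_edge_transitive_def
  proof (intro ballI)
    fix e e' assume "e \<in> gedges (Cay G C)" "e' \<in> gedges (Cay G C)"
    then obtain g h g' h' where e: "e = {g, h}" "e' = {g', h'}"
      and G: "g \<in> carrier G" "h \<in> carrier G" "g' \<in> carrier G" "h' \<in> carrier G"
      and gh: "g \<otimes> inv h \<in> C" "g' \<otimes> inv h' \<in> C"
      by (auto simp: Cay_def)
    obtain \<sigma> where \<sigma>: "\<sigma> \<in> Aut_fixing G C"
      and alt: "\<sigma> (g \<otimes> inv h) = g' \<otimes> inv h' \<or> \<sigma> (g \<otimes> inv h) = inv (g' \<otimes> inv h')"
      using R gh by blast
    have "\<sigma> \<in> auto G" using \<sigma> by (auto simp: Aut_fixing_def)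
    then interpret \<sigma>: group_hom G G \<sigma> by (rule autoD)
    have \<sigma>gh: "\<sigma> (g \<otimes> inv h) = \<sigma> g \<otimes> inv (\<sigma> h)" using G by simp
    \<comment> \<open>The translation by \<open>inv (\<sigma> h) \<otimes> b\<close> is forced by
      sending \<open>h\<close> to \<open>b\<close>; the assumption on \<open>a\<close> and
      \<open>b\<close> then sends \<open>g\<close> to \<open>a\<close>. Both orders of the target
      edge are needed below.\<close>
    have *: "\<exists>\<tau>\<in>normal_cay_aut G C. \<tau> ` {g, h} = {a, b}"
      if "a \<in> carrier G" "b \<in> carrier G" "\<sigma> g \<otimes> inv (\<sigma> h) = a \<otimes> inv b" for a b
    proof (rule bexI[where x = "\<lambda>x\<in>carrier G. \<sigma> x \<otimes> (inv (\<sigma> h) \<otimes> b)"])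
      have "\<sigma> g \<otimes> (inv (\<sigma> h) \<otimes> b) = a \<otimes> inv b \<otimes> b"
        using that G by (simp add: m_assoc[symmetric])
      moreover have "\<sigma> h \<otimes> (inv (\<sigma> h) \<otimes> b) = b"
        using that G by (simp add: m_assoc[symmetric])
      ultimately show "(\<lambda>x\<in>carrier G. \<sigma> x \<otimes> (inv (\<sigma> h) \<otimes> b)) ` {g, h} = {a, b}"
        using that G by (simp add: m_assoc)
      show "(\<lambda>x\<in>carrier G. \<sigma> x \<otimes> (inv (\<sigma> h) \<otimes> b)) \<in> normal_cay_aut G C"
        unfolding normal_cay_aut_eq
        by (rule CollectI, intro exI conjI, rule refl) (use \<sigma> that G in auto)
    qed
    show "\<exists>\<tau>\<in>normal_cay_aut G C. \<tau> ` e = e'"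
      using alt
    proof
      assume "\<sigma> (g \<otimes> inv h) = g' \<otimes> inv h'"
      then show ?thesis using *[of g' h'] G \<sigma>gh e by simp
    next
      assume "\<sigma> (g \<otimes> inv h) = inv (g' \<otimes> inv h')"
      then show ?thesis using *[of h' g'] G \<sigma>gh e by (simp add: inv_mult_group insert_commute)
    qed
  qed
qed

end

section \<open>Quotients by invariant normal subgroups\<close>

lemma (in group) quotient_inverse_closed_generating_set:
  assumes C: "inverse_closed_generating_set G C" and N: "N \<lhd> G" and disj: "C \<inter> N = {}"
  shows "inverse_closed_generating_set (G Mod N) (quot_set G C N)"
proof -
  interpret N: normal N G by (rule N)
  note CD = inverse_closed_generating_setD[OF C]
  \<comment> \<open>Disjointness of \<open>C\<close> and \<open>N\<close> is what keeps the identity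
    coset out of \<open>quot_set G C N\<close>.\<close>
  have "c <# N \<noteq> N" if "c \<in> C" for c
    using that disj CD(2) by (subst N.lcoset_eq_subgroup_iff) auto
  moreover have "inv\<^bsub>G Mod N\<^esub> (c <# N) = inv c <# N" if "c \<in> C" for c
    using that CD(2) N.FactGroup_inv_lcoset by blast
  moreover have "generate (G Mod N) (quot_set G C N) = carrier (G Mod N)"
    using group_hom.generate_img[OF N.lcoset_group_hom CD(2)] CD(4)
    by (simp add: quot_set_def N.FactGroup_carrier_lcoset)
  ultimately show ?thesis
    using CD N.lcoset_in_FactGroup
    by (auto simp: inverse_closed_generating_set_def quot_set_def)
qed

text \<open>Since \<open>\<sigma>\<close> maps \<open>N\<close> onto itself, it maps the coset of
  \<open>g\<close> onto the coset of \<open>\<sigma> g\<close>; it also permutes the cosets of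
  elements of \<open>C\<close> because it preserves \<open>C\<close>.\<close>

lemma (in group) induced_automorphism:
  assumes N: "N \<lhd> G" and \<sigma>: "\<sigma> \<in> Aut_fixing G C" and inv: "\<sigma> ` N = N" and C: "C \<subseteq> carrier G"
  obtains \<tau> where "\<tau> \<in> Aut_fixing (G Mod N) (quot_set G C N)"
    and "\<And>g. g \<in> carrier G \<Longrightarrow> \<tau> (g <# N) = \<sigma> g <# N"
proof
  \<comment> \<open>Taking images of whole cosets avoids a choice of representatives; the
    restriction makes the map extensional, as \<open>auto\<close> demands.\<close>
  define \<tau> where "\<tau> = (\<lambda>U\<in>carrier (G Mod N). \<sigma> ` U)"
  interpret N: normal N G by (rule N)
  have a: "\<sigma> \<in> auto G" and \<sigma>C: "\<sigma> ` C = C" using \<sigma> by (auto simp: Aut_fixing_def)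
  interpret \<sigma>: group_hom G G \<sigma> using a by (rule autoD)
  have \<sigma>G: "\<sigma> ` carrier G = carrier G" using autoD(3)[OF a] by (simp add: bij_betw_def)
  have "\<sigma> ` (g <# N) = \<sigma> g <# N" if "g \<in> carrier G" for g
  proof -
    have "\<sigma> ` (g <# N) = (\<lambda>n. \<sigma> g \<otimes> \<sigma> n) ` N"
      using that N.mem_carrier by (force simp: l_coset_def)
    also have "\<dots> = \<sigma> g <# (\<sigma> ` N)" by (auto simp: l_coset_def)
    finally show ?thesis by (simp add: inv)
  qed
  then show \<tau>: "\<tau> (g <# N) = \<sigma> g <# N" if "g \<in> carrier G" for g
    using that N.lcoset_in_FactGroup by (simp add: \<tau>_def)
  have img: "\<tau> ` ((\<lambda>g. g <# N) ` A) = (\<lambda>g. g <# N) ` (\<sigma> ` A)" if "A \<subseteq> carrier G" for A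
    unfolding image_image using \<tau> that by (intro image_cong) auto
  \<comment> \<open>Cosets are subsets of the carrier, where \<open>\<sigma>\<close> is injective,
    so they are determined by their images.\<close>
  have "inj_on \<tau> (carrier (G Mod N))"
  proof (rule inj_onI)
    fix U V assume XY: "U \<in> carrier (G Mod N)" "V \<in> carrier (G Mod N)" "\<tau> U = \<tau> V"
    then have "U \<subseteq> carrier G" "V \<subseteq> carrier G"
      using N.subset by (auto simp: N.FactGroup_carrier_lcoset l_coset_def)
    then show "U = V"
      using XY autoD(3)[OF a] by (auto simp: \<tau>_def bij_betw_def inj_on_image_eq_iff)
  qed
  moreover have "\<tau> ` carrier (G Mod N) = carrier (G Mod N)"
    using img[of "carrier G"] by (simp add: N.FactGroup_carrier_lcoset \<sigma>G)
  moreover have "\<tau> \<in> hom (G Mod N) (G Mod N)"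
    by (rule homI)
       (auto simp: N.FactGroup_carrier_lcoset N.FactGroup_mult_lcoset \<tau> simp del: mult_FactGroup)
  moreover have "\<tau> ` quot_set G C N = quot_set G C N"
    using img[OF C] by (simp add: quot_set_def \<sigma>C)
  ultimately show "\<tau> \<in> Aut_fixing (G Mod N) (quot_set G C N)"
    by (auto simp: Aut_fixing_def auto_def Bij_def bij_betw_def \<tau>_def)
qed

text \<open>By \<open>normal_edge_transitive_iff\<close> it suffices to move one coset of a
  generator to another up to inversion; the automorphism induced by one that does this for
  representatives in \<open>C\<close> does it.\<close>

lemma (in group) quotient_normal_edge_transitive:
  assumes C: "inverse_closed_generating_set G C" and net: "normal_edge_transitive G C"
    and N: "N \<in> inv_normals G C" and disj: "C \<inter> N = {}"
  shows "normal_edge_transitive (G Mod N) (quot_set G C N)"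
proof -
  have "N \<lhd> G" using N by (simp add: inv_normals_def)
  then interpret N: normal N G .
  note CD = inverse_closed_generating_setD[OF C]
  show ?thesis
    unfolding group.normal_edge_transitive_iff[OF N.factorgroup_is_group
        quotient_inverse_closed_generating_set[OF C \<open>N \<lhd> G\<close> disj]]
  proof (intro ballI)
    fix U V assume "U \<in> quot_set G C N" "V \<in> quot_set G C N"
    then obtain c d where cd: "c \<in> C" "d \<in> C" "U = c <# N" "V = d <# N"
      by (auto simp: quot_set_def)
    then obtain \<sigma> where \<sigma>: "\<sigma> \<in> Aut_fixing G C" "\<sigma> c = d \<or> \<sigma> c = inv d"
      using net normal_edge_transitive_iff[OF C] by blast
    have "\<sigma> ` N = N" using N \<sigma>(1) by (simp add: inv_normals_def)
    then obtain \<tau> where \<tau>: "\<tau> \<in> Aut_fixing (G Mod N) (quot_set G C N)"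
      "\<And>g. g \<in> carrier G \<Longrightarrow> \<tau> (g <# N) = \<sigma> g <# N"
      using induced_automorphism[OF \<open>N \<lhd> G\<close> \<sigma>(1) _ CD(2)] by blast
    have G: "c \<in> carrier G" "d \<in> carrier G" using cd CD(2) by auto
    have "\<tau> U = V \<or> \<tau> U = inv\<^bsub>G Mod N\<^esub> V"
      using \<sigma>(2) unfolding cd(3,4) \<tau>(2)[OF G(1)] N.FactGroup_inv_lcoset[OF G(2)]
      by (elim disjE) simp_all
    then show "\<exists>\<tau>\<in>Aut_fixing (G Mod N) (quot_set G C N). \<tau> U = V \<or> \<tau> U = inv\<^bsub>G Mod N\<^esub> V"
      by (rule bexI[OF _ \<tau>(1)])
  qed
qed

lemma (in group) FactGroup_finite: "finite (carrier G) \<Longrightarrow> finite (carrier (G Mod N))"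
  by (simp add: carrier_FactGroup)

text \<open>Correspondence respecting the automorphisms: an invariant proper normal subgroup
  \<open>K\<close> of the quotient has a preimage \<open>M\<close> which is again invariant, proper
  and normal, and contains \<open>N\<close>. Maximality forces \<open>M = N\<close>.\<close>

lemma (in group) quotient_inv_normals_trivial:
  assumes C: "C \<subseteq> carrier G" and N: "N \<in> max_inv_normals G C"
  shows "inv_normals (G Mod N) (quot_set G C N) = {{\<one>\<^bsub>G Mod N\<^esub>}}"
proof -
  have NI: "N \<in> inv_normals G C" and max: "\<And>M. M \<in> inv_normals G C \<Longrightarrow> N \<subseteq> M \<Longrightarrow> M = N"
    using N by (auto simp: max_inv_normals_def)
  then have "N \<lhd> G" "N \<noteq> carrier G" by (auto simp: inv_normals_def)
  interpret N: normal N G by (rule \<open>N \<lhd> G\<close>)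
  interpret Q: group "G Mod N" by (rule N.factorgroup_is_group)
  interpret \<pi>: group_hom G "G Mod N" "\<lambda>g. g <# N" by (rule N.lcoset_group_hom)
  have triv: "{\<one>\<^bsub>G Mod N\<^esub>} \<in> inv_normals (G Mod N) (quot_set G C N)"
  proof -
    have "{\<one>\<^bsub>G Mod N\<^esub>} \<noteq> carrier (G Mod N)"
    proof
      assume "{\<one>\<^bsub>G Mod N\<^esub>} = carrier (G Mod N)"
      then have "g <# N = N" if "g \<in> carrier G" for g
        using N.lcoset_in_FactGroup[OF that] by auto
      then have "carrier G \<subseteq> N" using N.lcoset_eq_subgroup_iff by blast
      then show False using N.subset \<open>N \<noteq> carrier G\<close> by blast
    qed
    moreover have "\<sigma> ` {\<one>\<^bsub>G Mod N\<^esub>} = {\<one>\<^bsub>G Mod N\<^esub>}"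
      if "\<sigma> \<in> Aut_fixing (G Mod N) (quot_set G C N)" for \<sigma>
      using that group_hom.hom_one[OF Q.autoD(4)] by (auto simp: Aut_fixing_def)
    ultimately show ?thesis
      using Q.one_is_normal by (auto simp: inv_normals_def)
  qed
  have "K = {\<one>\<^bsub>G Mod N\<^esub>}" if K: "K \<in> inv_normals (G Mod N) (quot_set G C N)" for K
  proof -
    define M where "M = {g \<in> carrier G. g <# N \<in> K}"
    have KQ: "K \<lhd> (G Mod N)" "K \<noteq> carrier (G Mod N)"
      and Kinv: "\<And>\<sigma>. \<sigma> \<in> Aut_fixing (G Mod N) (quot_set G C N) \<Longrightarrow> \<sigma> ` K = K"
      using K by (auto simp: inv_normals_def)
    interpret K: normal K "G Mod N" by (rule KQ)
    have MK: "(\<lambda>g. g <# N) ` M = K"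
      using K.subset by (auto simp: M_def N.FactGroup_carrier_lcoset)
    have "subgroup M G"
      by unfold_locales
         (auto simp: M_def K.m_closed simp del: mult_FactGroup one_FactGroup)
    moreover have "x \<otimes> h \<otimes> inv x \<in> M" if "x \<in> carrier G" "h \<in> M" for x h
      using that K.inv_op_closed2 by (auto simp: M_def simp del: mult_FactGroup)
    ultimately have "M \<lhd> G" by (rule normal_invI)
    moreover have "M \<noteq> carrier G"
      using KQ(2) MK N.FactGroup_carrier_lcoset by metis
    moreover have "\<sigma> ` M = M" if \<sigma>: "\<sigma> \<in> Aut_fixing G C" for \<sigma>
    proof -
      have a: "\<sigma> \<in> auto G" using \<sigma> by (simp add: Aut_fixing_def)
      have "\<sigma> ` N = N" using NI \<sigma> by (simp add: inv_normals_def)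
      then obtain \<tau> where \<tau>: "\<tau> \<in> Aut_fixing (G Mod N) (quot_set G C N)"
        "\<And>g. g \<in> carrier G \<Longrightarrow> \<tau> (g <# N) = \<sigma> g <# N"
        using induced_automorphism[OF \<open>N \<lhd> G\<close> \<sigma> _ C] by blast
      have "bij_betw \<tau> (carrier (G Mod N)) (carrier (G Mod N))"
        using \<tau>(1) by (intro Q.autoD) (simp add: Aut_fixing_def)
      then have inj: "inj_on \<tau> (carrier (G Mod N))" by (simp add: bij_betw_def)
      \<comment> \<open>The induced \<open>\<tau>\<close> maps \<open>K\<close> onto itself; its
        injectivity supplies the direction from \<open>\<sigma> g\<close> back to
        \<open>g\<close>.\<close>
      have *: "\<sigma> g <# N \<in> K \<longleftrightarrow> g <# N \<in> K" if "g \<in> carrier G" for g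
      proof -
        have "\<sigma> g <# N \<in> K \<longleftrightarrow> \<tau> (g <# N) \<in> \<tau> ` K"
          unfolding \<tau>(2)[OF that] Kinv[OF \<tau>(1)] ..
        also have "\<dots> \<longleftrightarrow> g <# N \<in> K"
          by (rule inj_on_image_mem_iff[OF inj N.lcoset_in_FactGroup[OF that] K.subset])
        finally show ?thesis .
      qed
      have "\<sigma> ` carrier G = carrier G" using autoD(3)[OF a] by (simp add: bij_betw_def)
      then have "\<sigma> ` M = {g \<in> \<sigma> ` carrier G. g <# N \<in> K}"
        using * by (force simp: M_def)
      then show ?thesis by (simp only: \<open>\<sigma> ` carrier G = carrier G\<close> M_def)
    qed
    ultimately have "M \<in> inv_normals G C" by (simp add: inv_normals_def)
    moreover have "N \<subseteq> M"
    proof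
      fix n assume n: "n \<in> N"
      then have "n \<in> carrier G" by (rule N.mem_carrier)
      then have "n <# N = \<one>\<^bsub>G Mod N\<^esub>" using n by (simp add: N.lcoset_eq_subgroup_iff)
      then have "n <# N \<in> K" using K.one_closed by (simp only:)
      then show "n \<in> M" using \<open>n \<in> carrier G\<close> by (simp add: M_def)
    qed
    ultimately have "M = N" by (rule max)
    \<comment> \<open>All of \<open>N\<close> collapses to the identity coset, so \<open>K\<close>,
      the image of \<open>M = N\<close>, is trivial.\<close>
    have "(\<lambda>g. g <# N) ` N = {N}"
      using N.lcoset_eq_subgroup_iff[OF N.mem_carrier] by (simp add: image_constant[OF N.one_closed])
    then show ?thesis using MK \<open>M = N\<close> by simp
  qed
  then show ?thesis using triv by blast
qed

section \<open>Maximal invariant normal subgroups and independent families\<close>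

lemma (in group) inv_normals_disjoint:
  assumes C: "inverse_closed_generating_set G C" and net: "normal_edge_transitive G C"
    and N: "N \<in> inv_normals G C"
  shows "C \<inter> N = {}"
proof (rule ccontr)
  note CD = inverse_closed_generating_setD[OF C]
  interpret N: normal N G using N by (simp add: inv_normals_def)
  assume "C \<inter> N \<noteq> {}"
  then obtain c where c: "c \<in> C" "c \<in> N" by blast
  \<comment> \<open>One common element drags all of \<open>C\<close> into \<open>N\<close>: some
    automorphism in \<open>Aut_fixing G C\<close> takes \<open>c\<close> to \<open>d\<close> or its
    inverse, and invariance keeps the image in \<open>N\<close>.\<close>
  have "d \<in> N" if "d \<in> C" for d
  proof -
    obtain \<sigma> where \<sigma>: "\<sigma> \<in> Aut_fixing G C" "\<sigma> c = d \<or> \<sigma> c = inv d"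
      using net normal_edge_transitive_iff[OF C] c(1) \<open>d \<in> C\<close> by blast
    have "\<sigma> c \<in> N" using N \<sigma>(1) c(2) by (auto simp: inv_normals_def)
    moreover have "d \<in> carrier G" using that CD(2) by auto
    ultimately show ?thesis using \<sigma>(2) N.m_inv_closed by fastforce
  qed
  then have "carrier G \<subseteq> N"
    using generate_subgroup_incl[of C N] N.subgroup_axioms CD(4) by auto
  then show False using N N.subset by (auto simp: inv_normals_def)
qed

text \<open>The trivial subgroup is invariant and, in a nontrivial group, proper; finiteness then
  provides a maximal member.\<close>

lemma (in group) max_inv_normals_nonempty:
  assumes "finite (carrier G)" "carrier G \<noteq> {\<one>}"
  shows "max_inv_normals G C \<noteq> {}"
proof -
  have "\<sigma> ` {\<one>} = {\<one>}" if "\<sigma> \<in> Aut_fixing G C" for \<sigma>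
    using that group_hom.hom_one[OF autoD(4)] by (auto simp: Aut_fixing_def)
  then have "{\<one>} \<in> inv_normals G C"
    using one_is_normal assms by (auto simp: inv_normals_def)
  moreover have "finite (inv_normals G C)"
    using assms(1) by (rule_tac finite_subset[of _ "Pow (carrier G)"])
      (auto simp: inv_normals_def dest!: normal_imp_subgroup subgroup.subset)
  ultimately obtain N where "N \<in> inv_normals G C" "\<forall>M\<in>inv_normals G C. N \<subseteq> M \<longrightarrow> N = M"
    using finite_has_maximal[of "inv_normals G C"] by auto
  then show ?thesis by (auto simp: max_inv_normals_def)
qed

lemma (in group) normal_INT:
  assumes "I \<noteq> {}" "\<And>i. i \<in> I \<Longrightarrow> N i \<lhd> G"
  shows "(\<Inter>i\<in>I. N i) \<lhd> G"
proof (rule normal_invI)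
  show "subgroup (\<Inter>i\<in>I. N i) G"
    using assms by (intro subgroups_Inter) (auto dest: normal_imp_subgroup)
  show "x \<otimes> h \<otimes> inv x \<in> (\<Inter>i\<in>I. N i)" if "x \<in> carrier G" "h \<in> (\<Inter>i\<in>I. N i)" for x h
    using that assms by (auto intro: normal.inv_op_closed2)
qed

lemma (in group) subgroup_subset_set_mult:
  assumes H: "subgroup H G" and K: "subgroup K G"
  shows "H \<subseteq> H <#> K" "K \<subseteq> H <#> K"
proof -
  have "H <#> {\<one>} \<subseteq> H <#> K" "{\<one>} <#> K \<subseteq> H <#> K"
    using subgroup.one_closed[OF H] subgroup.one_closed[OF K] by (simp_all add: mono_set_mult)
  then show "H \<subseteq> H <#> K" "K \<subseteq> H <#> K"
    using lcos_mult_one[OF subgroup.subset[OF K]] coset_mult_one[OF subgroup.subset[OF H]]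
    by (simp_all add: l_coset_eq_set_mult r_coset_eq_set_mult)
qed

text \<open>The product \<open>M <#> K\<close> is normal and invariant and contains
  \<open>K\<close>. Were it proper, maximality would make it equal to \<open>K\<close>, and then
  \<open>M\<close> would lie in \<open>K\<close>.\<close>

lemma (in group) max_inv_normals_cover:
  assumes K: "K \<in> max_inv_normals G C" and M: "M \<lhd> G"
    and inv: "\<And>\<sigma>. \<sigma> \<in> Aut_fixing G C \<Longrightarrow> \<sigma> ` M = M" and notsub: "\<not> M \<subseteq> K"
  shows "M <#> K = carrier G"
proof (rule ccontr)
  assume ne: "M <#> K \<noteq> carrier G"
  have KI: "K \<in> inv_normals G C" using K by (simp add: max_inv_normals_def)
  then interpret K: normal K G by (simp add: inv_normals_def)
  interpret M: normal M G by (rule M)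
  have sub: "M \<subseteq> M <#> K" "K \<subseteq> M <#> K"
    using subgroup_subset_set_mult[OF M.subgroup_axioms K.subgroup_axioms] .
  have "M <#> K \<lhd> G"
  proof (rule normal_invI)
    show "subgroup (M <#> K) G" using mult_norm_subgroup[OF M K.subgroup_axioms] .
    fix x h assume x: "x \<in> carrier G" and "h \<in> M <#> K"
    then obtain m n where mn: "m \<in> M" "n \<in> K" "h = m \<otimes> n" by (auto simp: set_mult_def)
    \<comment> \<open>Conjugation is multiplicative, so it acts on the two factors
      separately.\<close>
    then have "x \<otimes> h \<otimes> inv x = (x \<otimes> m \<otimes> inv x) \<otimes> (x \<otimes> n \<otimes> inv x)"
      using x by (simp add: m_assoc inv_solve_left)
    moreover have "x \<otimes> m \<otimes> inv x \<in> M" "x \<otimes> n \<otimes> inv x \<in> K"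
      using mn x M.inv_op_closed2 K.inv_op_closed2 by simp_all
    ultimately show "x \<otimes> h \<otimes> inv x \<in> M <#> K" unfolding set_mult_def by blast
  qed
  moreover have "\<sigma> ` (M <#> K) = M <#> K" if \<sigma>: "\<sigma> \<in> Aut_fixing G C" for \<sigma>
  proof -
    have "\<sigma> \<in> hom G G" using \<sigma> by (auto simp: Aut_fixing_def auto_def)
    then have "\<sigma> ` (M <#> K) = \<sigma> ` M <#> \<sigma> ` K"
      by (rule set_mult_hom) (use M.subset K.subset in auto)
    then show ?thesis using inv[OF \<sigma>] KI \<sigma> by (simp add: inv_normals_def)
  qed
  ultimately have "M <#> K \<in> inv_normals G C" using ne by (simp add: inv_normals_def)
  then have "M <#> K = K" using K sub(2) by (auto simp: max_inv_normals_def)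
  then show False using sub(1) notsub by simp
qed

text \<open>The last conjunct is surjectivity of the map from \<open>G\<close> to the product of the
  quotients, phrased with representatives \<open>f i\<close> in place of tuples of cosets.\<close>

lemma (in group) max_inv_normals_independent_family:
  assumes fin: "finite (carrier G)" and triv: "carrier G \<noteq> {\<one>}"
  shows "\<exists>k\<ge>1. \<exists>N :: nat \<Rightarrow> 'a set.
    (\<forall>i\<in>{1..k}. N i \<in> max_inv_normals G C) \<and> Phi_rel G C = (\<Inter>i\<in>{1..k}. N i) \<and>
    (\<forall>f. (\<forall>i\<in>{1..k}. f i \<in> carrier G) \<longrightarrow>
       (\<exists>g\<in>carrier G. \<forall>i\<in>{1..k}. g <# N i = f i <# N i))"
proof -
  define indep where "indep k N \<longleftrightarrow> (\<forall>f :: nat \<Rightarrow> 'a. (\<forall>i\<in>{1..k}. f i \<in> carrier G) \<longrightarrow>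
       (\<exists>g\<in>carrier G. \<forall>i\<in>{1..k}. g <# N i = f i <# N i))" for k :: nat and N :: "nat \<Rightarrow> 'a set"
  have normal: "N \<lhd> G" if "N \<in> max_inv_normals G C" for N
    using that by (simp add: max_inv_normals_def inv_normals_def)
  have extend: "\<exists>k'\<ge>1. \<exists>N'. (\<forall>i\<in>{1..k'}. N' i \<in> max_inv_normals G C) \<and>
      Phi_rel G C = (\<Inter>i\<in>{1..k'}. N' i) \<and> indep k' N'"
    if "k \<ge> 1" "\<forall>i\<in>{1..k}. N i \<in> max_inv_normals G C" "indep k N" for k N
    using that
  \<comment> \<open>The order of the intersection is the measure: adjoining some \<open>K\<close>
    that does not contain the intersection makes it strictly smaller.\<close>
  proof (induction "card (\<Inter>i\<in>{1..k}. N i)" arbitrary: k N rule: less_induct)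
    case less
    note k = less.prems(1) and N = less.prems(2) and ind = less.prems(3)
    let ?M = "\<Inter>i\<in>{1..k}. N i"
    have M: "?M \<lhd> G" using k N normal by (intro normal_INT) auto
    show ?case
    proof (cases "\<forall>K\<in>max_inv_normals G C. ?M \<subseteq> K")
      case True
      then have "?M \<subseteq> Phi_rel G C" by (simp only: Phi_rel_def le_Inf_iff)
      moreover have "Phi_rel G C \<subseteq> ?M" using N unfolding Phi_rel_def by blast
      ultimately show ?thesis using k N ind by (metis subset_antisym)
    next
      case False
      then obtain K where K: "K \<in> max_inv_normals G C" "\<not> ?M \<subseteq> K" by blast
      have "\<sigma> ` ?M = ?M" if \<sigma>: "\<sigma> \<in> Aut_fixing G C" for \<sigma>
      proof -
        have "inj_on \<sigma> (carrier G)"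
          using autoD(3) \<sigma> by (auto simp: Aut_fixing_def bij_betw_def)
        moreover have "\<forall>i\<in>{1..k}. N i \<subseteq> carrier G"
          using N normal by (blast dest: normal_imp_subgroup subgroup.subset)
        \<comment> \<open>Images commute with this intersection because \<open>\<sigma>\<close> is
          injective on the carrier; index 1 witnesses that the family is nonempty.\<close>
        ultimately have "\<sigma> ` ?M = (\<Inter>i\<in>{1..k}. \<sigma> ` N i)"
          by (rule image_INT[where j = 1]) (use k in simp)
        also have "\<dots> = ?M"
          using N \<sigma> by (intro INF_cong) (auto simp: max_inv_normals_def inv_normals_def)
        finally show ?thesis .
      qed
      with max_inv_normals_cover[OF K(1) M _ K(2)] have cover: "?M <#> K = carrier G" by blast
      define N' where "N' = N(Suc k := K)"
      have N'_eq: "N' i = N i" if "i \<in> {1..k}" for i using that by (auto simp: N'_def)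
      have inter: "(\<Inter>i\<in>{1..Suc k}. N' i) = ?M \<inter> K"
        using N'_eq by (auto simp: atLeastAtMostSuc_conv N'_def)
      have "finite ?M" using M fin by (meson finite_subset normal_imp_subgroup subgroup.subset)
      then have "card (\<Inter>i\<in>{1..Suc k}. N' i) < card ?M"
        unfolding inter using K(2) by (intro psubset_card_mono) auto
      moreover have "indep (Suc k) N'"
        unfolding indep_def
      proof (intro allI impI)
        fix f :: "nat \<Rightarrow> 'a" assume f: "\<forall>i\<in>{1..Suc k}. f i \<in> carrier G"
        then have "\<forall>i\<in>{1..k}. f i \<in> carrier G" by simp
        then obtain g where g: "g \<in> carrier G" "\<And>i. i \<in> {1..k} \<Longrightarrow> g <# N i = f i <# N i"
          using ind[unfolded indep_def, THEN spec, of f] by auto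
        have "f (Suc k) \<in> carrier G" using f by simp
        \<comment> \<open>The element \<open>g\<close> is already right modulo the first
          \<open>k\<close> subgroups. Splitting its discrepancy from \<open>f (Suc k)\<close> as
          \<open>m \<otimes> n\<close> gives the corrected element \<open>g \<otimes> m\<close>: the
          factor \<open>m\<close> lies in every \<open>N i\<close> and so leaves the old cosets
          alone, while the remaining error \<open>n\<close> lies in \<open>K\<close>.\<close>
        then have "inv g \<otimes> f (Suc k) \<in> ?M <#> K" using g(1) unfolding cover by simp
        then obtain m n where mn: "m \<in> ?M" "n \<in> K" "inv g \<otimes> f (Suc k) = m \<otimes> n"
          by (auto simp: set_mult_def)
        interpret M: normal ?M G by (rule M)
        interpret K: normal K G using normal K(1) by blast
        have mG: "m \<in> carrier G" and nG: "n \<in> carrier G"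
          using mn M.mem_carrier K.mem_carrier by blast+
        have "f (Suc k) = g \<otimes> (m \<otimes> n)"
          using mn(3) g(1) \<open>f (Suc k) \<in> carrier G\<close> mG nG by (metis inv_solve_left m_closed)
        then have "inv (g \<otimes> m) \<otimes> f (Suc k) = n"
          using g(1) mG nG inv_solve_left'[of n "g \<otimes> m" "f (Suc k)"] by (simp add: m_assoc)
        then have "f (Suc k) <# K = (g \<otimes> m) <# K"
          using \<open>f (Suc k) \<in> carrier G\<close> g(1) mG mn(2) by (subst K.lcoset_eq_iff) auto
        moreover have "(g \<otimes> m) <# N i = f i <# N i" if i: "i \<in> {1..k}" for i
        proof -
          interpret Ni: normal "N i" G using normal N i by blast
          have "(g \<otimes> m) <# N i = g <# N i"
            using mn(1) i g(1) mG by (subst Ni.lcoset_eq_iff) (auto simp: m_assoc[symmetric])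
          then show ?thesis using g(2)[OF i] by simp
        qed
        ultimately show "\<exists>g\<in>carrier G. \<forall>i\<in>{1..Suc k}. g <# N' i = f i <# N' i"
          using g(1) mG N'_eq
          by (intro bexI[of _ "g \<otimes> m"]) (auto simp: atLeastAtMostSuc_conv N'_def)
      qed
      moreover have "\<forall>i\<in>{1..Suc k}. N' i \<in> max_inv_normals G C"
        using N K(1) by (auto simp: N'_def)
      ultimately show ?thesis by (intro less.hyps[of N' "Suc k"]) auto
    qed
  qed
  obtain K where K: "K \<in> max_inv_normals G C"
    using max_inv_normals_nonempty[OF fin triv] by blast
  \<comment> \<open>The process starts from a single maximal subgroup, where \<open>f 1\<close>
    itself is the required element.\<close>
  have "indep 1 (\<lambda>_. K)" by (auto simp: indep_def)
  then show ?thesis using extend[of 1 "\<lambda>_. K"] K by (simp add: indep_def)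
qed

section \<open>The quotient Cayley graph as a full subdirect product\<close>

definition image_graph :: "('v \<Rightarrow> 'w) \<Rightarrow> 'v sgraph \<Rightarrow> 'w sgraph" where
  "image_graph f \<Gamma> = \<lparr>gverts = f ` gverts \<Gamma>, gedges = (`) f ` gedges \<Gamma>\<rparr>"

text \<open>Injectivity on the vertices keeps the two ends of each edge distinct.\<close>

lemma image_graph_simple:
  assumes "simple_graph \<Gamma>" "inj_on f (gverts \<Gamma>)"
  shows "simple_graph (image_graph f \<Gamma>)"
proof -
  have "card (f ` e) = card e" if "e \<in> gedges \<Gamma>" for e
    using that assms by (meson card_image inj_on_subset simple_graph_def)
  then show ?thesis using assms(1) by (auto simp: simple_graph_def image_graph_def)
qed

lemma graph_iso_image_graph:
  assumes "simple_graph \<Gamma>" "inj_on f (gverts \<Gamma>)"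
  shows "graph_iso f \<Gamma> (image_graph f \<Gamma>)"
  using assms image_graph_simple[OF assms]
  by (auto simp: graph_iso_def full_graph_hom_def graph_hom_def bij_betw_def image_graph_def)

text \<open>The map is injective because \<open>M\<close> is the intersection of the
  \<open>N i\<close>, and surjective by \<open>surj\<close>. For the graphs, a generator
  \<open>c\<close> joining two cosets of \<open>M\<close> joins their images in every coordinate,
  and an edge in one coordinate lifts to an edge modulo \<open>M\<close> through the same
  \<open>c\<close>.\<close>

lemma (in group) quotient_subdirect_product:
  fixes N :: "'i \<Rightarrow> 'a set"
  assumes fin: "finite (carrier G)" and C: "inverse_closed_generating_set G C"
    and I: "I \<noteq> {}" and N: "\<And>i. i \<in> I \<Longrightarrow> N i \<lhd> G" "\<And>i. i \<in> I \<Longrightarrow> C \<inter> N i = {}"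
    and surj: "\<And>f. (\<And>i. i \<in> I \<Longrightarrow> f i \<in> carrier G) \<Longrightarrow>
      \<exists>g\<in>carrier G. \<forall>i\<in>I. g <# N i = f i <# N i"
  defines "M \<equiv> \<Inter>i\<in>I. N i"
  shows "\<exists>\<zeta>. (\<forall>g\<in>carrier G. \<zeta> (g <# M) = (\<lambda>i\<in>I. g <# N i)) \<and>
    \<zeta> \<in> iso (G Mod M) (product_group I (\<lambda>i. G Mod N i)) \<and>
    (\<exists>\<Delta>. full_subdirect_product I (\<lambda>i. Cay (G Mod N i) (quot_set G C (N i))) \<Delta> \<and>
         graph_iso \<zeta> (Cay (G Mod M) (quot_set G C M)) \<Delta>)"
proof -
  note CD = inverse_closed_generating_setD[OF C]
  have nM: "M \<lhd> G" unfolding M_def using I N(1) by (intro normal_INT) auto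
  interpret M: normal M G by (rule nM)
  have CM: "C \<inter> M = {}" using I N(2) unfolding M_def by blast
  let ?\<Gamma> = "\<lambda>i. Cay (G Mod N i) (quot_set G C (N i))"
  let ?\<Gamma>M = "Cay (G Mod M) (quot_set G C M)"
  \<comment> \<open>The set product with \<open>N i\<close> enlarges a coset of \<open>M\<close> to
    the coset of \<open>N i\<close> containing it, so no representative has to be chosen.\<close>
  define \<zeta> where "\<zeta> U = (\<lambda>i\<in>I. U <#> N i)" for U
  have \<zeta>: "\<zeta> (g <# M) = (\<lambda>i\<in>I. g <# N i)" if g: "g \<in> carrier G" for g
  proof -
    have "(g <# M) <#> N i = g <# N i" if i: "i \<in> I" for i
    proof -
      interpret Ni: normal "N i" G by (rule N(1)[OF i])
      have "M <#> N i = N i"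
      proof
        have "M <#> N i \<subseteq> N i <#> N i" unfolding M_def using i by (intro mono_set_mult INT_lower) auto
        then show "M <#> N i \<subseteq> N i" using subgroup_mult_id[OF Ni.subgroup_axioms] by simp
        show "N i \<subseteq> M <#> N i"
          by (rule subgroup_subset_set_mult[OF M.subgroup_axioms Ni.subgroup_axioms])
      qed
      then show ?thesis
        using setmult_lcos_assoc[OF M.subset Ni.subset g] by simp
    qed
    then show ?thesis unfolding \<zeta>_def by (rule restrict_ext)
  qed
  have inj: "inj_on \<zeta> (carrier (G Mod M))"
  proof (rule inj_onI)
    fix U V assume "U \<in> carrier (G Mod M)" "V \<in> carrier (G Mod M)" and eq: "\<zeta> U = \<zeta> V"
    then obtain g h where gh: "g \<in> carrier G" "h \<in> carrier G" "U = g <# M" "V = h <# M"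
      by (auto simp: M.FactGroup_carrier_lcoset)
    \<comment> \<open>Agreement in every coordinate puts \<open>inv h \<otimes> g\<close> into all
      \<open>N i\<close>, hence into \<open>M\<close>.\<close>
    have "inv h \<otimes> g \<in> N i" if i: "i \<in> I" for i
    proof -
      have "g <# N i = h <# N i"
        using fun_cong[OF eq, of i] i unfolding gh(3,4) \<zeta>[OF gh(1)] \<zeta>[OF gh(2)] by simp
      then show ?thesis unfolding normal.lcoset_eq_iff[OF N(1)[OF i] gh(1,2)] .
    qed
    then show "U = V" using gh M.lcoset_eq_iff by (simp add: M_def)
  qed
  have img: "\<zeta> ` carrier (G Mod M) = (\<Pi>\<^sub>E i\<in>I. carrier (G Mod N i))"
  proof
    show "\<zeta> ` carrier (G Mod M) \<subseteq> (\<Pi>\<^sub>E i\<in>I. carrier (G Mod N i))"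
      using \<zeta> normal.lcoset_in_FactGroup[OF N(1)]
      by (auto simp: M.FactGroup_carrier_lcoset)
    show "(\<Pi>\<^sub>E i\<in>I. carrier (G Mod N i)) \<subseteq> \<zeta> ` carrier (G Mod M)"
    proof
      fix u assume u: "u \<in> (\<Pi>\<^sub>E i\<in>I. carrier (G Mod N i))"
      then have "\<forall>i\<in>I. \<exists>g\<in>carrier G. u i = g <# N i"
        using normal.FactGroup_carrier_lcoset[OF N(1)] by (fastforce simp: PiE_iff)
      then obtain f where f: "\<And>i. i \<in> I \<Longrightarrow> f i \<in> carrier G" "\<And>i. i \<in> I \<Longrightarrow> u i = f i <# N i"
        by metis
      \<comment> \<open>Here \<open>surj\<close> glues the separate representatives
        \<open>f i\<close> into one element, in the manner of the Chinese remainder theorem.\<close>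
      then obtain g where g: "g \<in> carrier G" "\<forall>i\<in>I. g <# N i = f i <# N i"
        using surj[of f] by blast
      then have "u = \<zeta> (g <# M)"
        unfolding \<zeta>[OF g(1)] using f(2) u by (auto simp: PiE_iff extensional_def fun_eq_iff)
      then show "u \<in> \<zeta> ` carrier (G Mod M)" using M.lcoset_in_FactGroup[OF g(1)] by blast
    qed
  qed
  have "\<zeta> \<in> hom (G Mod M) (product_group I (\<lambda>i. G Mod N i))"
  proof (rule homI)
    show "\<zeta> U \<in> carrier (product_group I (\<lambda>i. G Mod N i))" if "U \<in> carrier (G Mod M)" for U
      using imageI[OF that, of \<zeta>] by (simp only: img carrier_product_group)
    fix U V assume "U \<in> carrier (G Mod M)" "V \<in> carrier (G Mod M)"
    then obtain g h where gh: "g \<in> carrier G" "h \<in> carrier G" "U = g <# M" "V = h <# M"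
      by (auto simp: M.FactGroup_carrier_lcoset)
    then show "\<zeta> (U \<otimes>\<^bsub>G Mod M\<^esub> V) = \<zeta> U \<otimes>\<^bsub>product_group I (\<lambda>i. G Mod N i)\<^esub> \<zeta> V"
      using normal.FactGroup_mult_lcoset[OF N(1)]
      by (simp add: M.FactGroup_mult_lcoset \<zeta> fun_eq_iff restrict_def del: mult_FactGroup)
  qed
  then have iso: "\<zeta> \<in> iso (G Mod M) (product_group I (\<lambda>i. G Mod N i))"
    using inj img by (simp add: iso_def bij_betw_def)

  have genM: "inverse_closed_generating_set (G Mod M) (quot_set G C M)"
    by (rule quotient_inverse_closed_generating_set[OF C nM CM])
  have gen: "inverse_closed_generating_set (G Mod N i) (quot_set G C (N i))" if "i \<in> I" for i
    using quotient_inverse_closed_generating_set[OF C N[OF that]] .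
  have simpleM: "simple_graph ?\<Gamma>M"
    by (rule group.Cay_simple_graph[OF M.factorgroup_is_group genM FactGroup_finite[OF fin]])
  have simple: "simple_graph (?\<Gamma> i)" if "i \<in> I" for i
    by (rule group.Cay_simple_graph[OF normal.factorgroup_is_group[OF N(1)[OF that]]
          gen[OF that] FactGroup_finite[OF fin]])
  \<comment> \<open>Adjacency is expressed through an element \<open>c\<close> of \<open>C\<close>
    itself and not through its coset, so that one \<open>c\<close> can be carried between the
    quotients by \<open>M\<close> and by the \<open>N i\<close>.\<close>
  have quotient_edge: "{g <# K, h <# K} \<in> gedges (Cay (G Mod K) (quot_set G C K)) \<longleftrightarrow>
      (\<exists>c\<in>C. g <# K = (c \<otimes> h) <# K)"
    if K: "K \<lhd> G" "C \<inter> K = {}" and gh: "g \<in> carrier G" "h \<in> carrier G" for K g h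
  proof -
    interpret K: normal K G by (rule K(1))
    interpret Q: group "G Mod K" by (rule K.factorgroup_is_group)
    have "(g <# K) \<otimes>\<^bsub>G Mod K\<^esub> inv\<^bsub>G Mod K\<^esub> (h <# K) = c <# K \<longleftrightarrow> g <# K = (c \<otimes> h) <# K"
      if "c \<in> C" for c
    proof -
      have c: "c \<in> carrier G" using that CD(2) by auto
      have "g <# K = (c \<otimes> h) <# K \<longleftrightarrow> g <# K = (c <# K) \<otimes>\<^bsub>G Mod K\<^esub> (h <# K)"
        using gh c by (simp add: K.FactGroup_mult_lcoset del: mult_FactGroup)
      then show ?thesis
        using Q.inv_solve_right[of "c <# K" "g <# K" "h <# K"] K.lcoset_in_FactGroup gh c
        by metis
    qed
    then show ?thesis
      using K.lcoset_in_FactGroup gh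
      unfolding Q.Cay_edge_iff[OF quotient_inverse_closed_generating_set[OF C K]]
      by (auto simp: quot_set_def simp del: mult_FactGroup)
  qed
  have vertsM: "gverts ?\<Gamma>M = carrier (G Mod M)" and verts: "gverts (?\<Gamma> i) = carrier (G Mod N i)" for i
    by (simp_all add: Cay_def)
  have edge_cases: "\<exists>g\<in>carrier G. \<exists>h\<in>carrier G. e = {g <# K, h <# K}"
    if "K \<lhd> G" "e \<in> gedges (Cay (G Mod K) (quot_set G C K))" for K e
    using that normal.FactGroup_carrier_lcoset[OF that(1)] by (auto simp: Cay_def)

  \<comment> \<open>As an image, \<open>\<Delta>\<close> makes \<open>\<zeta>\<close> full by
    construction. It has all vertices of the direct product, but its edges are those whose
    coordinates come from a common generator.\<close>
  define \<Delta> where "\<Delta> = image_graph \<zeta> ?\<Gamma>M"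
  have graph_iso: "graph_iso \<zeta> ?\<Gamma>M \<Delta>"
    unfolding \<Delta>_def using simpleM inj by (intro graph_iso_image_graph) (simp_all add: vertsM)
  have simple\<Delta>: "simple_graph \<Delta>"
    using graph_iso by (simp add: graph_iso_def full_graph_hom_def graph_hom_def)
  have verts\<Delta>: "gverts \<Delta> = (\<Pi>\<^sub>E i\<in>I. carrier (G Mod N i))"
    by (simp add: \<Delta>_def image_graph_def vertsM img)
  have mem: "(\<lambda>i\<in>I. g <# N i) \<in> (\<Pi>\<^sub>E i\<in>I. carrier (G Mod N i))" if "g \<in> carrier G" for g
    using that normal.lcoset_in_FactGroup[OF N(1)] by auto
  have edges\<Delta>: "\<exists>g\<in>carrier G. \<exists>h\<in>carrier G.
      e = {\<lambda>i\<in>I. g <# N i, \<lambda>i\<in>I. h <# N i} \<and> (\<forall>i\<in>I. {g <# N i, h <# N i} \<in> gedges (?\<Gamma> i))"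
    if e: "e \<in> gedges \<Delta>" for e
  proof -
    obtain e' where e': "e' \<in> gedges ?\<Gamma>M" "e = \<zeta> ` e'"
      using e by (auto simp: \<Delta>_def image_graph_def)
    obtain g h where gh: "g \<in> carrier G" "h \<in> carrier G" "e' = {g <# M, h <# M}"
      using edge_cases[OF nM e'(1)] by blast
    obtain c where c: "c \<in> C" "g <# M = (c \<otimes> h) <# M"
      using quotient_edge[OF nM CM gh(1,2)] e'(1) gh(3) by blast
    have "c \<otimes> h \<in> carrier G" using c CD(2) gh(2) by auto
    then have eq: "(\<lambda>i\<in>I. g <# N i) = (\<lambda>i\<in>I. (c \<otimes> h) <# N i)"
      using \<zeta>[OF gh(1)] \<zeta> c(2) by simp
    have "g <# N i = (c \<otimes> h) <# N i" if "i \<in> I" for i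
      using fun_cong[OF eq, of i] that by simp
    then have "\<forall>i\<in>I. {g <# N i, h <# N i} \<in> gedges (?\<Gamma> i)"
      using quotient_edge[OF N gh(1,2)] c(1) by blast
    then show ?thesis using gh e'(2) \<zeta> by auto
  qed
  have "subgraph_of \<Delta> (direct_product_graph I ?\<Gamma>)"
    unfolding subgraph_of_def
  proof (intro conjI subsetI)
    show "simple_graph \<Delta>" by (rule simple\<Delta>)
    show "u \<in> gverts (direct_product_graph I ?\<Gamma>)" if "u \<in> gverts \<Delta>" for u
      using that by (simp add: verts\<Delta> direct_product_graph_def verts)
    fix e assume "e \<in> gedges \<Delta>"
    then obtain g h where gh: "g \<in> carrier G" "h \<in> carrier G"
      "e = {\<lambda>i\<in>I. g <# N i, \<lambda>i\<in>I. h <# N i}" "\<forall>i\<in>I. {g <# N i, h <# N i} \<in> gedges (?\<Gamma> i)"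
      using edges\<Delta> by blast
    show "e \<in> gedges (direct_product_graph I ?\<Gamma>)"
      unfolding direct_product_graph_def verts sgraph.simps
      by (rule CollectI, intro exI conjI, rule gh(3)) (use gh(4) mem[OF gh(1)] mem[OF gh(2)] in auto)
  qed
  moreover have "full_graph_epi (\<lambda>u. u i) \<Delta> (?\<Gamma> i)" if i: "i \<in> I" for i
  proof -
    interpret Ni: normal "N i" G by (rule N(1)[OF i])
    have fwd: "(\<lambda>u. u i) ` e \<in> gedges (?\<Gamma> i)" if "e \<in> gedges \<Delta>" for e
      using edges\<Delta>[OF that] i by auto
    have bwd: "e \<in> (\<lambda>e. (\<lambda>u. u i) ` e) ` gedges \<Delta>" if e: "e \<in> gedges (?\<Gamma> i)" for e
    proof -
      obtain g h where gh: "g \<in> carrier G" "h \<in> carrier G" "e = {g <# N i, h <# N i}"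
        using edge_cases[OF N(1)[OF i] e] by blast
      then obtain c where c: "c \<in> C" "g <# N i = (c \<otimes> h) <# N i"
        using quotient_edge[OF N[OF i] gh(1,2)] e by blast
      \<comment> \<open>The representative \<open>g\<close> need not be adjacent to \<open>h\<close>
        modulo \<open>M\<close>. It is replaced by \<open>c \<otimes> h\<close>, which has the same
        coset of \<open>N i\<close> and is adjacent to \<open>h\<close> modulo
        \<open>M\<close>.\<close>
      have ch: "c \<otimes> h \<in> carrier G" using c CD(2) gh(2) by auto
      then have "{(c \<otimes> h) <# M, h <# M} \<in> gedges ?\<Gamma>M"
        using quotient_edge[OF nM CM ch gh(2)] c(1) by blast
      then have "\<zeta> ` {(c \<otimes> h) <# M, h <# M} \<in> gedges \<Delta>"
        unfolding \<Delta>_def image_graph_def sgraph.simps by (rule imageI)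
      moreover have "(\<lambda>u. u i) ` \<zeta> ` {(c \<otimes> h) <# M, h <# M} = e"
        using \<zeta>[OF ch] \<zeta>[OF gh(2)] i gh(3) c(2) by simp
      ultimately show ?thesis by blast
    qed
    have "(\<lambda>u. u i) ` gverts \<Delta> = gverts (?\<Gamma> i)"
    proof
      show "(\<lambda>u. u i) ` gverts \<Delta> \<subseteq> gverts (?\<Gamma> i)"
        using i by (auto simp: verts\<Delta> verts)
      show "gverts (?\<Gamma> i) \<subseteq> (\<lambda>u. u i) ` gverts \<Delta>"
      proof
        fix U assume "U \<in> gverts (?\<Gamma> i)"
        then obtain g where "g \<in> carrier G" "U = g <# N i"
          by (auto simp: verts Ni.FactGroup_carrier_lcoset)
        then show "U \<in> (\<lambda>u. u i) ` gverts \<Delta>"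
          using mem i unfolding verts\<Delta> by (intro image_eqI[where x = "\<lambda>j\<in>I. g <# N j"]) auto
      qed
    qed
    then show ?thesis
      using fwd bwd simple\<Delta> simple[OF i]
      unfolding full_graph_epi_def full_graph_hom_def graph_hom_def by blast
  qed
  ultimately have "full_subdirect_product I ?\<Gamma> \<Delta>"
    by (simp add: full_subdirect_product_def)
  then show ?thesis using \<zeta> iso graph_iso by blast
qed

section \<open>Decomposition of the Cayley graph modulo \<open>\<Phi>\<close>\<close>

theorem theorem1p2:
  fixes G :: "('a, 'b) monoid_scheme" and C :: "'a set" and \<Phi> :: "'a set"
  assumes "group G" and "finite (carrier G)" and "carrier G \<noteq> {\<one>\<^bsub>G\<^esub>}"
    and "inverse_closed_generating_set G C"
    and "normal_edge_transitive G C"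
  defines "\<Phi> \<equiv> Phi_rel G C"
  shows "\<exists>k\<ge>1. \<exists>N :: nat \<Rightarrow> 'a set.
     (\<forall>i\<in>{1..k}. N i \<in> max_inv_normals G C) \<and>
     \<Phi> = (\<Inter>i\<in>{1..k}. N i) \<and>
     (\<exists>\<zeta>. (\<forall>g\<in>carrier G. \<zeta> (g <#\<^bsub>G\<^esub> \<Phi>) = (\<lambda>i\<in>{1..k}. g <#\<^bsub>G\<^esub> N i)) \<and>
          \<zeta> \<in> iso (G Mod \<Phi>) (product_group {1..k} (\<lambda>i. G Mod N i)) \<and>
          (\<forall>i\<in>{1..k}.
             inverse_closed_generating_set (G Mod N i) (quot_set G C (N i)) \<and>
             connected_graph (Cay (G Mod N i) (quot_set G C (N i))) \<and>
             normal_edge_transitive (G Mod N i) (quot_set G C (N i)) \<and>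
             finite (carrier (G Mod N i)) \<and>
             characteristically_simple (G Mod N i) \<and>
             inv_normals (G Mod N i) (quot_set G C (N i)) = {{\<one>\<^bsub>G Mod N i\<^esub>}}) \<and>
          inverse_closed_generating_set (G Mod \<Phi>) (quot_set G C \<Phi>) \<and>
          (\<exists>\<Delta>. full_subdirect_product {1..k} (\<lambda>i. Cay (G Mod N i) (quot_set G C (N i))) \<Delta> \<and>
               graph_iso \<zeta> (Cay (G Mod \<Phi>) (quot_set G C \<Phi>)) \<Delta>))"
proof -
  interpret group G by (rule assms(1))
  note fin = assms(2) and C = assms(4) and net = assms(5)
  obtain k and N :: "nat \<Rightarrow> 'a set" where k: "k \<ge> 1"
    and N: "\<And>i. i \<in> {1..k} \<Longrightarrow> N i \<in> max_inv_normals G C"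
    and \<Phi>: "\<Phi> = (\<Inter>i\<in>{1..k}. N i)"
    and surj: "\<And>f. (\<And>i. i \<in> {1..k} \<Longrightarrow> f i \<in> carrier G) \<Longrightarrow>
       \<exists>g\<in>carrier G. \<forall>i\<in>{1..k}. g <#\<^bsub>G\<^esub> N i = f i <#\<^bsub>G\<^esub> N i"
    using max_inv_normals_independent_family[OF fin assms(3), of C] unfolding \<Phi>_def by metis
  have NI: "N i \<in> inv_normals G C" if "i \<in> {1..k}" for i
    using N[OF that] by (simp add: max_inv_normals_def)
  have normal: "N i \<lhd> G" if "i \<in> {1..k}" for i
    using NI[OF that] by (simp add: inv_normals_def)
  have disj: "C \<inter> N i = {}" if "i \<in> {1..k}" for i
    by (rule inv_normals_disjoint[OF C net NI[OF that]])
  have I: "{1..k} \<noteq> {}" using k by simp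
  have "\<Phi> \<lhd> G" unfolding \<Phi> by (rule normal_INT[OF I normal])
  \<comment> \<open>As \<open>k\<close> is at least 1, \<open>\<Phi>\<close> lies in some
    \<open>N i\<close>, and that subgroup misses \<open>C\<close>.\<close>
  moreover have "C \<inter> \<Phi> = {}" unfolding \<Phi> using disj I by blast
  ultimately have gen\<Phi>: "inverse_closed_generating_set (G Mod \<Phi>) (quot_set G C \<Phi>)"
    by (rule quotient_inverse_closed_generating_set[OF C])
  obtain \<zeta> where \<zeta>: "\<forall>g\<in>carrier G. \<zeta> (g <#\<^bsub>G\<^esub> \<Phi>) = (\<lambda>i\<in>{1..k}. g <#\<^bsub>G\<^esub> N i)"
    "\<zeta> \<in> iso (G Mod \<Phi>) (product_group {1..k} (\<lambda>i. G Mod N i))"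
    "\<exists>\<Delta>. full_subdirect_product {1..k} (\<lambda>i. Cay (G Mod N i) (quot_set G C (N i))) \<Delta> \<and>
         graph_iso \<zeta> (Cay (G Mod \<Phi>) (quot_set G C \<Phi>)) \<Delta>"
    using quotient_subdirect_product[OF fin C I normal disj surj] unfolding \<Phi> by blast
  have quotients: "inverse_closed_generating_set (G Mod N i) (quot_set G C (N i)) \<and>
      connected_graph (Cay (G Mod N i) (quot_set G C (N i))) \<and>
      normal_edge_transitive (G Mod N i) (quot_set G C (N i)) \<and>
      finite (carrier (G Mod N i)) \<and>
      characteristically_simple (G Mod N i) \<and>
      inv_normals (G Mod N i) (quot_set G C (N i)) = {{\<one>\<^bsub>G Mod N i\<^esub>}}" if i: "i \<in> {1..k}" for i
  proof -
    interpret Q: group "G Mod N i" by (rule normal.factorgroup_is_group[OF normal[OF i]])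
    have gen: "inverse_closed_generating_set (G Mod N i) (quot_set G C (N i))"
      by (rule quotient_inverse_closed_generating_set[OF C normal[OF i] disj[OF i]])
    \<comment> \<open>This fact serves twice: it is a claim in itself, and it yields characteristic
      simplicity of the quotient.\<close>
    have triv: "inv_normals (G Mod N i) (quot_set G C (N i)) = {{\<one>\<^bsub>G Mod N i\<^esub>}}"
      by (rule quotient_inv_normals_trivial[OF inverse_closed_generating_setD(2)[OF C] N[OF i]])
    show ?thesis
      using gen triv Q.Cay_connected[OF gen] FactGroup_finite[OF fin]
        quotient_normal_edge_transitive[OF C net NI[OF i] disj[OF i]]
        Q.characteristically_simple_if_inv_normals_trivial[OF triv] by blast
  qed
  show ?thesis
    by (intro exI[of _ k] exI[of _ N] exI[of _ \<zeta>] conjI k \<Phi> \<zeta> gen\<Phi> ballI N quotients)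
qed

end
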